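(* Let $m$ be a positive integer. In each of the following cases the displayed identity holds, and the triple consisting of $n_1=6m+4$ and the denominators $n_2,n_3$ of the second and third unit fractions on the right-hand side is a wild solution of the Erdős–Straus equation for $24m+1$. (1) If $m=10\ell-1+c(30\ell-1)$ with $\ell$ a positive integer and $c\in\mathbb N$, then $$\frac{4}{24m+1}=\frac{1}{6m+4}+\frac{1}{4\ell(3c+1)(24m+1)}+\frac{1}{4\ell(3c+1)(30\ell-1)(24m+1)}.$$ (2) If $m=10\ell+4+c(15\ell+7)$ with $\ell$ a positive integer and $c\in\mathbb N$, then $$\frac{4}{24m+1}=\frac{1}{6m+4}+\frac{1}{(2\ell+1)(3c+2)(24m+1)}+\frac{1}{2(2\ell+1)(3c+2)(15\ell+7)(24m+1)}.$$ (3) If $m=20\ell+8+c(30\ell+13)$ with $\ell$ a positive integer and $c\in\mathbb N$, then $$\frac{4}{24m+1}=\frac{1}{6m+4}+\frac{1}{2(2\ell+1)(3c+2)(24m+1)}+\frac{1}{(2\ell+1)(3c+2)(30\ell+13)(24m+1)}.$$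
   Context: $\mathbb N$ denotes the set of nonnegative integers. For a positive integer $m$, the Erdős–Straus equation for $n=24m+1$ is $\frac{4}{n}=\frac1{n_1}+\frac1{n_2}+\frac1{n_3}$ in positive integers $n_1,n_2,n_3$. For $n_1=6m+k$ with $1\le k\le 12m$ one has $\frac{4}{24m+1}=\frac{1}{6m+k}+\frac{4k-1}{(6m+k)(24m+1)}$. A solution $(n_1,n_2,n_3)$ is called a wild solution if $n_1=6m+k$ for some integer $1\le k\le 12m$ and there exist an integer $L\ge 2$ (called a multiplier) and positive integers $J_1,J_2$ (called the numerator summands) such that $J_1+J_2=L(4k-1)$, $\gcd(L,J_1,J_2)=1$, $\frac1{n_2}=\frac{J_1}{L(6m+k)(24m+1)}$ and $\frac1{n_3}=\frac{J_2}{L(6m+k)(24m+1)}$. *)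

theory Defs
  imports Complex_Main
begin

text \<open>Positive integers are encoded as elements of \<^typ>\<open>int\<close> with explicit positivity
  conditions, so that terms such as \<open>4 * k - 1\<close> involve no truncated subtraction.\<close>

definition erdos_straus_solution :: "int \<Rightarrow> int \<Rightarrow> int \<Rightarrow> int \<Rightarrow> bool" where
  "erdos_straus_solution n n1 n2 n3 \<longleftrightarrow>
     n1 > 0 \<and> n2 > 0 \<and> n3 > 0 \<and>
     (4 / of_int n :: rat) = 1 / of_int n1 + 1 / of_int n2 + 1 / of_int n3"

text \<open>Wild solutions of the equation for \<open>24 * m + 1\<close>: \<open>L\<close> is the multiplier, and \<open>J1\<close>, \<open>J2\<close> are
  the numerator summands, belonging to \<open>n2\<close> and \<open>n3\<close> in this order. They arise by splitting
  \<open>(4 * k - 1) / ((6 * m + k) * (24 * m + 1))\<close> into two unit fractions after expanding it by \<open>L\<close>.\<close>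

definition wild_solution :: "int \<Rightarrow> int \<Rightarrow> int \<Rightarrow> int \<Rightarrow> bool" where
  "wild_solution m n1 n2 n3 \<longleftrightarrow>
     erdos_straus_solution (24 * m + 1) n1 n2 n3 \<and>
     (\<exists>k. 1 \<le> k \<and> k \<le> 12 * m \<and> n1 = 6 * m + k \<and>
       (\<exists>L J1 J2. L \<ge> 2 \<and> J1 > 0 \<and> J2 > 0 \<and>
          J1 + J2 = L * (4 * k - 1) \<and>
          gcd L (gcd J1 J2) = 1 \<and>
          (1 / of_int n2 :: rat) = of_int J1 / of_int (L * (6 * m + k) * (24 * m + 1)) \<and>
          (1 / of_int n3 :: rat) = of_int J2 / of_int (L * (6 * m + k) * (24 * m + 1))))"

end

theory Submission
  imports Defs
begin

text \<open>All three families have \<open>k = 4\<close>, so that \<open>4 * k - 1 = 15\<close>. In each of them \<open>6 * m + 4\<close> factors,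
  and it remains to split \<open>15 * L\<close> into two coprime divisors of \<open>L * (6 * m + 4)\<close>:
  \<open>15 * (2 * l) = (30 * l - 1) + 1\<close>, \<open>15 * (2 * l + 1) = (30 * l + 14) + 1\<close> and
  \<open>15 * (2 * l + 1) = (30 * l + 13) + 2\<close>.\<close>

text \<open>The equations defining a wild solution are put in division-free form: for integer data
  only \<open>n2 * J1\<close> and \<open>n3 * J2\<close> have to be compared with the common
  denominator. The Erdos-Straus equation itself follows, since \<open>L\<close> cancels from
  \<open>J1 + J2 = L * (4 * k - 1)\<close>.\<close>

lemma wild_solutionI:
  fixes m k L J1 J2 n2 n3 :: int
  assumes "m > 0" "1 \<le> k" "k \<le> 12 * m" "L \<ge> 2" "J1 > 0" "J2 > 0"
    and sum: "J1 + J2 = L * (4 * k - 1)"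
    and gcd: "gcd L (gcd J1 J2) = 1"
    and n2: "n2 * J1 = L * (6 * m + k) * (24 * m + 1)"
    and n3: "n3 * J2 = L * (6 * m + k) * (24 * m + 1)"
  shows "wild_solution m (6 * m + k) n2 n3"
proof -
  define D where "D = L * (6 * m + k) * (24 * m + 1)"
  have "D > 0"
    unfolding D_def using assms by simp
  \<comment> \<open>Positivity is inherited from \<open>D\<close>: each product equals
    \<open>D > 0\<close> and its second factor is positive.\<close>
  have pos: "n2 > 0" "n3 > 0"
    using \<open>D > 0\<close> zero_less_mult_pos2[of n2 J1] zero_less_mult_pos2[of n3 J2] \<open>J1 > 0\<close> \<open>J2 > 0\<close>
    unfolding n2 n3 D_def by blast+
  have f: "(1 / of_int n :: rat) = of_int J / of_int D"
    if "n * J = D" "n > 0" for n J :: int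
  proof -
    have "(of_int D :: rat) = of_int n * of_int J"
      by (simp flip: that(1))
    then show ?thesis using that(2) \<open>D > 0\<close> by auto
  qed
  note f2 = f[OF n2[folded D_def] pos(1)] and f3 = f[OF n3[folded D_def] pos(2)]
  have "(1 / of_int n2 + 1 / of_int n3 :: rat) = of_int (L * (4 * k - 1)) / of_int D"
    unfolding f2 f3 sum[symmetric] by (simp add: add_divide_distrib)
  also have "\<dots> = of_int (4 * k - 1) / (of_int (6 * m + k) * of_int (24 * m + 1))"
    unfolding D_def of_int_mult using \<open>L \<ge> 2\<close> by simp
  also have "\<dots> = 4 / of_int (24 * m + 1) - 1 / of_int (6 * m + k)"
  proof -
    have "(of_int (6 * m + k) :: rat) \<noteq> 0" "(of_int (24 * m + 1) :: rat) \<noteq> 0"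
      unfolding of_int_eq_0_iff using \<open>m > 0\<close> \<open>1 \<le> k\<close> by linarith+
    \<comment> \<open>This difference explains the numerator \<open>4 * k - 1\<close>: it is what
      remains after subtracting \<open>1 / (6 * m + k)\<close> from
      \<open>4 / (24 * m + 1)\<close>.\<close>
    moreover have "(of_int (4 * k - 1) :: rat) = 4 * of_int (6 * m + k) - of_int (24 * m + 1)"
      by simp
    ultimately show ?thesis by (simp only: diff_divide_distrib) (simp del: of_int_add of_int_mult)
  qed
  finally have "erdos_straus_solution (24 * m + 1) (6 * m + k) n2 n3"
    unfolding erdos_straus_solution_def using \<open>m > 0\<close> \<open>1 \<le> k\<close> pos by linarith
  then show ?thesis
    unfolding wild_solution_def using assms(2-8) f2[unfolded D_def] f3[unfolded D_def]
    by (intro conjI exI[of _ k] exI[of _ L] exI[of _ J1] exI[of _ J2]) (assumption | rule refl)+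
qed

lemma wild_solution_identity:
  "wild_solution m n1 n2 n3 \<Longrightarrow>
    (4 / of_int (24 * m + 1) :: rat) = 1 / of_int n1 + 1 / of_int n2 + 1 / of_int n3"
  by (simp add: wild_solution_def erdos_straus_solution_def)

lemma wild_solution_family1:
  fixes m l c :: int
  assumes "m > 0" "l > 0" and m: "m = 10 * l - 1 + c * (30 * l - 1)"
  shows "wild_solution m (6 * m + 4)
    (4 * l * (3 * c + 1) * (24 * m + 1))
    (4 * l * (3 * c + 1) * (30 * l - 1) * (24 * m + 1))"
proof (rule wild_solutionI[of _ _ "2 * l" "30 * l - 1" "1"])
  \<comment> \<open>The part of \<open>m\<close> without \<open>c\<close> contributes
    \<open>60 * l - 2\<close>, a multiple of \<open>30 * l - 1\<close>, and \<open>c\<close> adds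
    \<open>6 * c * (30 * l - 1)\<close>. Hence \<open>J1\<close> divides
    \<open>6 * m + 4\<close>.\<close>
  have n1: "6 * m + 4 = 2 * (30 * l - 1) * (3 * c + 1)"
    by (simp add: m algebra_simps)
  show "4 * l * (3 * c + 1) * (24 * m + 1) * (30 * l - 1) = (2 * l) * (6 * m + 4) * (24 * m + 1)"
    unfolding n1 by (simp add: algebra_simps)
  show "4 * l * (3 * c + 1) * (30 * l - 1) * (24 * m + 1) * 1 = (2 * l) * (6 * m + 4) * (24 * m + 1)"
    unfolding n1 by (simp add: algebra_simps)
  show "gcd (2 * l) (gcd (30 * l - 1) 1) = 1"
    by simp
qed (use assms(1,2) in simp_all)

lemma wild_solution_family2:
  fixes m l c :: int
  assumes "m > 0" "l > 0" and m: "m = 10 * l + 4 + c * (15 * l + 7)"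
  shows "wild_solution m (6 * m + 4)
    ((2 * l + 1) * (3 * c + 2) * (24 * m + 1))
    (2 * (2 * l + 1) * (3 * c + 2) * (15 * l + 7) * (24 * m + 1))"
proof (rule wild_solutionI[of _ _ "2 * l + 1" "30 * l + 14" "1"])
  \<comment> \<open>Here \<open>J1 = 2 * (15 * l + 7)\<close> absorbs the factor 2 as well, so
    \<open>n2\<close> is left with \<open>3 * c + 2\<close> alone from
    \<open>6 * m + 4\<close>.\<close>
  have n1: "6 * m + 4 = 2 * (15 * l + 7) * (3 * c + 2)"
    by (simp add: m algebra_simps)
  show "(2 * l + 1) * (3 * c + 2) * (24 * m + 1) * (30 * l + 14) = (2 * l + 1) * (6 * m + 4) * (24 * m + 1)"
    unfolding n1 by (simp add: algebra_simps)
  show "2 * (2 * l + 1) * (3 * c + 2) * (15 * l + 7) * (24 * m + 1) * 1 = (2 * l + 1) * (6 * m + 4) * (24 * m + 1)"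
    unfolding n1 by (simp add: algebra_simps)
  show "gcd (2 * l + 1) (gcd (30 * l + 14) 1) = 1"
    by simp
qed (use assms(1,2) in simp_all)

lemma wild_solution_family3:
  fixes m l c :: int
  assumes "m > 0" "l > 0" and m: "m = 20 * l + 8 + c * (30 * l + 13)"
  shows "wild_solution m (6 * m + 4)
    (2 * (2 * l + 1) * (3 * c + 2) * (24 * m + 1))
    ((2 * l + 1) * (3 * c + 2) * (30 * l + 13) * (24 * m + 1))"
proof (rule wild_solutionI[of _ _ "2 * l + 1" "30 * l + 13" "2"])
  \<comment> \<open>The two factors \<open>30 * l + 13\<close> and 2 of \<open>6 * m + 4\<close>
    serve as \<open>J1\<close> and \<open>J2\<close>.\<close>
  have n1: "6 * m + 4 = 2 * (30 * l + 13) * (3 * c + 2)"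
    by (simp add: m algebra_simps)
  show "2 * (2 * l + 1) * (3 * c + 2) * (24 * m + 1) * (30 * l + 13) = (2 * l + 1) * (6 * m + 4) * (24 * m + 1)"
    unfolding n1 by (simp add: algebra_simps)
  show "(2 * l + 1) * (3 * c + 2) * (30 * l + 13) * (24 * m + 1) * 2 = (2 * l + 1) * (6 * m + 4) * (24 * m + 1)"
    unfolding n1 by (simp add: algebra_simps)
  \<comment> \<open>With \<open>J2 = 2\<close> a parity argument is required:
    \<open>30 * l + 13\<close> is odd, so the inner gcd is already 1.\<close>
  show "gcd (2 * l + 1) (gcd (30 * l + 13) 2) = 1"
    by (metis coprime_iff_gcd_eq_1 coprime_right_2_iff_odd even_add even_mult_iff even_numeral gcd_1_int gcd.commute odd_numeral)
qed (use assms(1,2) in simp_all)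

theorem theorem3p4:
  fixes m :: int
  assumes "m > 0"
  shows
    "(\<forall>l c :: int. l > 0 \<and> c \<ge> 0 \<and> m = 10 * l - 1 + c * (30 * l - 1) \<longrightarrow>
        (4 / of_int (24 * m + 1) :: rat) =
            1 / of_int (6 * m + 4)
          + 1 / of_int (4 * l * (3 * c + 1) * (24 * m + 1))
          + 1 / of_int (4 * l * (3 * c + 1) * (30 * l - 1) * (24 * m + 1)) \<and>
        wild_solution m (6 * m + 4)
          (4 * l * (3 * c + 1) * (24 * m + 1))
          (4 * l * (3 * c + 1) * (30 * l - 1) * (24 * m + 1))) \<and>
     (\<forall>l c :: int. l > 0 \<and> c \<ge> 0 \<and> m = 10 * l + 4 + c * (15 * l + 7) \<longrightarrow>
        (4 / of_int (24 * m + 1) :: rat) =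
            1 / of_int (6 * m + 4)
          + 1 / of_int ((2 * l + 1) * (3 * c + 2) * (24 * m + 1))
          + 1 / of_int (2 * (2 * l + 1) * (3 * c + 2) * (15 * l + 7) * (24 * m + 1)) \<and>
        wild_solution m (6 * m + 4)
          ((2 * l + 1) * (3 * c + 2) * (24 * m + 1))
          (2 * (2 * l + 1) * (3 * c + 2) * (15 * l + 7) * (24 * m + 1))) \<and>
     (\<forall>l c :: int. l > 0 \<and> c \<ge> 0 \<and> m = 20 * l + 8 + c * (30 * l + 13) \<longrightarrow>
        (4 / of_int (24 * m + 1) :: rat) =
            1 / of_int (6 * m + 4)
          + 1 / of_int (2 * (2 * l + 1) * (3 * c + 2) * (24 * m + 1))
          + 1 / of_int ((2 * l + 1) * (3 * c + 2) * (30 * l + 13) * (24 * m + 1)) \<and>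
        wild_solution m (6 * m + 4)
          (2 * (2 * l + 1) * (3 * c + 2) * (24 * m + 1))
          ((2 * l + 1) * (3 * c + 2) * (30 * l + 13) * (24 * m + 1)))"
  \<comment> \<open>The displayed identity is a component of \<open>wild_solution\<close>, so both
    claims of a case reduce to one family lemma, selected by the shape of the denominators.\<close>
  by (intro conjI allI impI; (rule wild_solution_identity)?; elim conjE;
      (rule wild_solution_family1[OF assms] | rule wild_solution_family2[OF assms]
        | rule wild_solution_family3[OF assms]); assumption)

end
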